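(* If a coded system $X$ is totally transitive, then it is mixing.
   Context: Let $\mathcal A$ be a finite alphabet with at least two elements, and let $\mathcal A^{\mathbb Z}$ carry the product topology. A shift space is a closed shift-invariant subset $X\subset\mathcal A^{\mathbb Z}$; $\mathcal B(X)$ is the set of all finite words (including the empty word) occurring in points of $X$, and $\mathcal B_n(X)$ the set of those of length $n$. A coded system is a shift space which is the closure in $\mathcal A^{\mathbb Z}$ of the set of label sequences of bi-infinite paths in some irreducible directed graph with at most countably many vertices and edges, whose edges are labeled by symbols of $\mathcal A$ (irreducible: every ordered pair of vertices is joined by a path). A shift space $X$ is totally transitive if for all $u,v\in\mathcal B(X)$ and any $n>0$ there is $w\in\mathcal B(X)$ such that $uwv\in\mathcal B(X)$ and $n$ divides $|uw|$; it is mixing if for all $u,v\in\mathcal B(X)$ there is $N>0$ such that for every $n>N$ there is $w\in\mathcal B_n(X)$ with $uwv\in\mathcal B(X)$. *)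

theory Defs
  imports "HOL-Analysis.Analysis" "Graph_Theory.Digraph_Component"
begin

section \<open>Shift spaces\<close>

definition full_shift :: "'a set \<Rightarrow> (int \<Rightarrow> 'a) topology" where
  "full_shift A = product_topology (\<lambda>_. discrete_topology A) UNIV"

definition shift_map :: "(int \<Rightarrow> 'a) \<Rightarrow> (int \<Rightarrow> 'a)" where
  "shift_map x = (\<lambda>i. x (i + 1))"

text \<open>Invariance is two-sided; the empty shift space is allowed.\<close>

definition shift_space :: "'a set \<Rightarrow> (int \<Rightarrow> 'a) set \<Rightarrow> bool" where
  "shift_space A X \<longleftrightarrow> closedin (full_shift A) X \<and> shift_map ` X = X"

definition language :: "(int \<Rightarrow> 'a) set \<Rightarrow> 'a list set" where
  "language X = {map (\<lambda>j. x (i + int j)) [0..<n] |x i n. x \<in> X}"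

definition language_n :: "nat \<Rightarrow> (int \<Rightarrow> 'a) set \<Rightarrow> 'a list set" where
  "language_n n X = {w \<in> language X. length w = n}"

definition totally_transitive :: "(int \<Rightarrow> 'a) set \<Rightarrow> bool" where
  "totally_transitive X \<longleftrightarrow>
    (\<forall>u\<in>language X. \<forall>v\<in>language X. \<forall>n>0.
      \<exists>w\<in>language X. u @ w @ v \<in> language X \<and> n dvd length (u @ w))"

definition mixing :: "(int \<Rightarrow> 'a) set \<Rightarrow> bool" where
  "mixing X \<longleftrightarrow>
    (\<forall>u\<in>language X. \<forall>v\<in>language X.
      \<exists>N>0. \<forall>n>N. \<exists>w\<in>language_n n X. u @ w @ v \<in> language X)"

section \<open>Coded systems\<close>

definition biinfinite_paths :: "('v, 'e) pre_digraph \<Rightarrow> (int \<Rightarrow> 'e) set" where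
  "biinfinite_paths G =
    {p. \<forall>i. p i \<in> arcs G \<and> head G (p i) = tail G (p (i + 1))}"

definition label_sequences :: "('v, 'e) pre_digraph \<Rightarrow> ('e \<Rightarrow> 'a) \<Rightarrow> (int \<Rightarrow> 'a) set" where
  "label_sequences G l = (\<lambda>p i. l (p i)) ` biinfinite_paths G"

text \<open>
  The directed graphs here may have loops and parallel edges. Irreducibility is
  \<^const>\<open>strongly_connected\<close>, which excludes the null graph and admits trivial
  paths. Neither choice affects which shift spaces are coded: the empty shift space is
  presented by a single vertex without edges.
\<close>

definition presents ::
  "'a set \<Rightarrow> ('v, 'e) pre_digraph \<Rightarrow> ('e \<Rightarrow> 'a) \<Rightarrow> (int \<Rightarrow> 'a) set \<Rightarrow> bool" where
  "presents A G l X \<longleftrightarrow>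
    wf_digraph G \<and> strongly_connected G \<and> countable (verts G) \<and> countable (arcs G) \<and>
    l \<in> arcs G \<rightarrow> A \<and> X = full_shift A closure_of label_sequences G l"

text \<open>
  A definition cannot quantify over the types of vertices and edges. Since the graphs
  are countable, nothing is lost by taking both to be natural numbers; see
  \<open>coded_systemI\<close> below.
\<close>

definition coded_system :: "'a set \<Rightarrow> (int \<Rightarrow> 'a) set \<Rightarrow> bool" where
  "coded_system A X \<longleftrightarrow>
    shift_space A X \<and> (\<exists>(G :: (nat, nat) pre_digraph) l. presents A G l X)"

lemma presents_nat:
  fixes G :: "('v, 'e) pre_digraph"
  assumes "presents A G l X"
  shows "\<exists>(H :: (nat, nat) pre_digraph) m. presents A H m X"
proof -
  define f where "f = to_nat_on (verts G)"
  define g where "g = to_nat_on (arcs G)"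
  define h where "h = inv_into (arcs G) g"
  define H where "H = \<lparr>verts = f ` verts G, arcs = g ` arcs G,
    tail = (\<lambda>e. f (tail G (h e))), head = (\<lambda>e. f (head G (h e)))\<rparr>"
  define m where "m = l \<circ> h"
  have wf: "wf_digraph G" and sc: "strongly_connected G"
    and l: "l \<in> arcs G \<rightarrow> A" and X: "X = full_shift A closure_of label_sequences G l"
    and cV: "countable (verts G)" and cE: "countable (arcs G)"
    using assms by (auto simp: presents_def)
  interpret wf_digraph G by (fact wf)
  have injf: "inj_on f (verts G)" and injg: "inj_on g (arcs G)"
    using cV cE by (simp_all add: f_def g_def inj_on_to_nat_on)
  have hg: "h (g e) = e" if "e \<in> arcs G" for e
    using that injg by (simp add: h_def)
  have simps: "verts H = f ` verts G" "arcs H = g ` arcs G"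
    "tail H = (\<lambda>e. f (tail G (h e)))" "head H = (\<lambda>e. f (head G (h e)))"
    by (simp_all add: H_def)
  have wfH: "wf_digraph H"
    by unfold_locales (auto simp: simps hg)
  have arcs: "(f u, f v) \<in> arcs_ends H" if "(u, v) \<in> arcs_ends G" for u v
    using that by (force simp: arcs_ends_conv simps hg image_iff)
  have reach: "(f u, f v) \<in> rtrancl_on (verts H) (arcs_ends H)"
    if "(u, v) \<in> rtrancl_on (verts G) (arcs_ends G)" for u v
    using that
  proof (induction v rule: rtrancl_on_induct)
    case base
    then show ?case by (auto simp: simps)
  next
    case (step y z)
    then show ?case
      using arcs by (meson rtrancl_on_into_rtrancl_on imageI simps(1)[symmetric, THEN equalityD1, THEN subsetD])
  qed
  have scH: "strongly_connected H"
    using sc reach by (auto simp: strongly_connected_def reachable_def simps)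
  have "label_sequences H m = label_sequences G l"
  proof (intro equalityI subsetI)
    fix x assume "x \<in> label_sequences H m"
    then obtain p where p: "p \<in> biinfinite_paths H" and x: "x = (\<lambda>i. m (p i))"
      by (auto simp: label_sequences_def)
    have hp: "h (p i) \<in> arcs G" for i
      using p by (auto simp: biinfinite_paths_def simps h_def intro: inv_into_into)
    moreover have "head G (h (p i)) = tail G (h (p (i + 1)))" for i
      using p hp injf by (auto simp: biinfinite_paths_def simps dest: inj_onD)
    ultimately have "(\<lambda>i. h (p i)) \<in> biinfinite_paths G"
      by (simp add: biinfinite_paths_def)
    then show "x \<in> label_sequences G l"
      unfolding label_sequences_def x m_def by (auto simp: image_iff)
  next
    fix x assume "x \<in> label_sequences G l"
    then obtain p where p: "p \<in> biinfinite_paths G" and x: "x = (\<lambda>i. l (p i))"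
      by (auto simp: label_sequences_def)
    have "(\<lambda>i. g (p i)) \<in> biinfinite_paths H"
      using p by (simp add: biinfinite_paths_def simps hg)
    moreover have "x = (\<lambda>i. m (g (p i)))"
      using p by (simp add: x m_def biinfinite_paths_def hg)
    ultimately show "x \<in> label_sequences H m"
      by (auto simp: label_sequences_def)
  qed
  moreover have "m \<in> arcs H \<rightarrow> A"
    using l by (auto simp: m_def simps hg)
  ultimately have "presents A H m X"
    using wfH scH X by (simp add: presents_def)
  then show ?thesis by blast
qed

lemma coded_systemI:
  fixes G :: "('v, 'e) pre_digraph"
  assumes "shift_space A X" "presents A G l X"
  shows "coded_system A X"
  using assms presents_nat unfolding coded_system_def by blast

end

theory Submission
  imports Defs
begin

text \<open>
  Fix a vertex \<open>o\<close> on a closed walk of length \<open>p > 0\<close>, and let the phases of a word \<open>v\<close> be the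
  residues modulo \<open>p\<close> of the lengths of walks that start at \<open>o\<close> and lead to the start of a walk
  labeled \<open>v\<close>. Pick a word \<open>m\<close> with the fewest phases. Total transitivity gives a word
  \<open>m @ w @ v\<close> with \<open>p\<close> dividing \<open>|m @ w|\<close>; its phases are phases of both \<open>m\<close> and \<open>v\<close>, so by
  minimality every phase of \<open>m\<close> is a phase of \<open>v\<close>. Taking for \<open>v\<close> an extension of \<open>m\<close> by one
  letter on the left, the phases of \<open>m\<close> are closed under adding 1, so every word has all
  phases. Now go from a walk labeled \<open>u\<close> to \<open>o\<close>, run around the closed walk sufficiently often,
  and continue to a walk labeled \<open>v\<close> in the phase that produces the desired length.
\<close>

section \<open>Words of a set of sequences\<close>

lemma languageI: "x \<in> X \<Longrightarrow> map (\<lambda>j. x (i + int j)) [0..<n] \<in> language X"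
  by (auto simp: language_def)

lemma language_factor:
  assumes "u @ w @ v \<in> language X"
  shows "w \<in> language X"
proof -
  obtain x i n where x: "x \<in> X" and e: "u @ w @ v = map (\<lambda>j. x (i + int j)) [0..<n]"
    using assms by (auto simp: language_def)
  have n: "n = length u + length w + length v"
    using arg_cong[OF e, of length] by simp
  have "w = map (\<lambda>j. x ((i + int (length u)) + int j)) [0..<length w]"
  proof (rule nth_equalityI)
    fix k assume k: "k < length w"
    have "w ! k = (u @ w @ v) ! (length u + k)"
      using k by (simp add: nth_append)
    also have "\<dots> = x (i + int (length u + k))"
      unfolding e using k n by simp
    finally show "w ! k = map (\<lambda>j. x ((i + int (length u)) + int j)) [0..<length w] ! k"
      using k by (simp add: add.assoc)
  qed simp
  then show ?thesis
    using languageI[OF x] by metis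
qed

text \<open>Points are bi-infinite, so every occurrence of a word has a letter on its left. This
  letter later shifts phases by 1.\<close>

lemma language_left_extension:
  assumes "v \<in> language X"
  obtains a where "a # v \<in> language X"
proof -
  obtain x i n where x: "x \<in> X" and v: "v = map (\<lambda>j. x (i + int j)) [0..<n]"
    using assms by (auto simp: language_def)
  have "map (\<lambda>j. x ((i - 1) + int j)) [0..<Suc n] = x (i - 1) # v"
    unfolding v by (subst map_upt_Suc) simp
  then show ?thesis
    using languageI[OF x] that by metis
qed

text \<open>A word sees only finitely many coordinates, and fixing these is an open condition; so
  passing to the closure may add points but adds no words.\<close>

lemma language_closure_of:
  assumes "Y \<subseteq> topspace (full_shift A)"
  shows "language (full_shift A closure_of Y) = language Y"
proof
  show "language Y \<subseteq> language (full_shift A closure_of Y)"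
    using closure_of_subset[OF assms] by (auto simp: language_def)
  show "language (full_shift A closure_of Y) \<subseteq> language Y"
  proof
    fix w assume "w \<in> language (full_shift A closure_of Y)"
    then obtain x i n where x: "x \<in> full_shift A closure_of Y"
      and w: "w = map (\<lambda>j. x (i + int j)) [0..<n]"
      by (auto simp: language_def)
    \<comment> \<open>The cylinder of all points of the full shift that agree with \<open>x\<close>
      on the window carrying \<open>w\<close>. It is open because only finitely many factors are
      restricted, each to a singleton inside \<open>A\<close>.\<close>
    let ?U = "\<Pi>\<^sub>E k\<in>UNIV. if k \<in> {i..<i + int n} then {x k} else A"
    have xA: "x k \<in> A" for k
      using in_closure_of[THEN iffD1, OF x] by (auto simp: full_shift_def PiE_iff)
    have "{k \<in> UNIV. (if k \<in> {i..<i + int n} then {x k} else A) \<noteq> topspace (discrete_topology A)}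
        \<subseteq> {i..<i + int n}"
      by auto
    then have "finite {k \<in> UNIV. (if k \<in> {i..<i + int n} then {x k} else A)
        \<noteq> topspace (discrete_topology A)}"
      by (rule finite_subset) simp
    then have "openin (full_shift A) ?U"
      unfolding full_shift_def openin_PiE_gen using xA by auto
    moreover have "x \<in> ?U"
      using xA by auto
    ultimately obtain y where y: "y \<in> Y" "y \<in> ?U"
      using x unfolding in_closure_of by blast
    have "y k = x k" if "k \<in> {i..<i + int n}" for k
      using PiE_mem[OF y(2), of k] that by auto
    then have "w = map (\<lambda>j. y (i + int j)) [0..<n]"
      unfolding w by auto
    then show "w \<in> language Y"
      using languageI[OF y(1)] by simp
  qed
qed

section \<open>Walks and their labels\<close>

context wf_digraph
begin

lemma cas_nth:
  assumes "cas a p b" "Suc i < length p"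
  shows "head G (p ! i) = tail G (p ! Suc i)"
  using assms
proof (induction p arbitrary: a i)
  case (Cons e p)
  then show ?case by (cases p; cases i) auto
qed simp

lemma closed_walk_biinfinite_path:
  assumes "awalk a p a" "p \<noteq> []"
  shows "(\<lambda>i. p ! nat (i mod int (length p))) \<in> biinfinite_paths G"
proof -
  let ?m = "length p"
  have m: "?m > 0" using assms by simp
  have "head G (p ! nat (i mod int ?m)) = tail G (p ! nat ((i + 1) mod int ?m))" for i
  proof (cases "i mod int ?m = int ?m - 1")
    \<comment> \<open>The junction where the period wraps around: the last arc must lead into the
      first, which holds because the walk is closed. All other junctions lie inside the
      walk.\<close>
    case True
    have "(i + 1) mod int ?m = (i mod int ?m + 1) mod int ?m"
      by (simp add: mod_simps)
    then have "(i + 1) mod int ?m = 0"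
      using True by simp
    moreover have "nat (i mod int ?m) = ?m - 1"
      using True m by simp
    moreover have "tail G (hd p) = a" "head G (last p) = a"
      using assms by (auto simp: awalk_conv hd_map last_map awalk_verts_conv split: if_splits)
    ultimately show ?thesis
      using assms(2) by (simp add: hd_conv_nth last_conv_nth)
  next
    case False
    then have lt: "i mod int ?m + 1 < int ?m"
      using pos_mod_bound[of "int ?m" i] m by linarith
    have ge: "0 \<le> i mod int ?m" using m by simp
    have "(i + 1) mod int ?m = (i mod int ?m + 1) mod int ?m"
      by (simp add: mod_simps)
    also have "\<dots> = i mod int ?m + 1"
      using lt ge by simp
    finally have "nat ((i + 1) mod int ?m) = Suc (nat (i mod int ?m))"
      using ge by (simp add: Suc_nat_eq_nat_zadd1)
    moreover have "Suc (nat (i mod int ?m)) < ?m"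
      using lt ge by linarith
    ultimately show ?thesis
      using cas_nth[of a p a] assms(1) by (simp add: awalk_def)
  qed
  moreover have "p ! nat (i mod int ?m) \<in> arcs G" for i
  proof -
    have "nat (i mod int ?m) < ?m" using m by (simp add: nat_less_iff)
    then show ?thesis using assms(1) by (auto simp: awalk_def)
  qed
  ultimately show ?thesis by (simp add: biinfinite_paths_def)
qed

lemma biinfinite_path_awalk:
  assumes "p \<in> biinfinite_paths G"
  shows "awalk (tail G (p i)) (map (\<lambda>j. p (i + int j)) [0..<n]) (tail G (p (i + int n)))"
proof (induction n)
  case 0
  then show ?case using assms by (simp add: biinfinite_paths_def awalk_Nil_iff)
next
  case (Suc n)
  have "awalk (tail G (p (i + int n))) [p (i + int n)] (tail G (p (i + int (Suc n))))"
    using assms arc_implies_awalk[of "p (i + int n)"]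
    by (simp add: biinfinite_paths_def algebra_simps)
  then show ?case
    using awalk_appendI[OF Suc] by simp
qed

lemma language_label_sequencesE:
  assumes "w \<in> language (label_sequences G l)"
  obtains a p b where "awalk a p b" "map l p = w"
proof -
  obtain q i n where "q \<in> biinfinite_paths G" "w = map (\<lambda>j. l (q (i + int j))) [0..<n]"
    using assms by (auto simp: language_def label_sequences_def)
  then show ?thesis
    using that[OF biinfinite_path_awalk[of q i n]] by simp
qed

lemma strongly_connected_awalk:
  assumes "strongly_connected G" "a \<in> verts G" "b \<in> verts G"
  obtains p where "awalk a p b"
  using assms by (auto simp: strongly_connected_def reachable_awalk)

text \<open>By strong connectivity the walk extends to a closed walk, whose periodic repetition is a
  bi-infinite path. Routing it through \<open>e\<close> keeps the closed walk nonempty even if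
  \<open>p\<close> is empty; in a graph without arcs the empty walk would have no label in the
  language.\<close>

lemma language_label_sequencesI:
  assumes sc: "strongly_connected G" and e: "e \<in> arcs G" and p: "awalk a p b"
  shows "map l p \<in> language (label_sequences G l)"
proof -
  obtain q where q: "awalk b q (tail G e)"
    using strongly_connected_awalk[OF sc] p e by (metis awalk_last_in_verts tail_in_verts)
  obtain r where r: "awalk (head G e) r a"
    using strongly_connected_awalk[OF sc] p e by (metis awalk_hd_in_verts head_in_verts)
  let ?c = "p @ q @ [e] @ r"
  have c: "awalk a ?c a"
    using p q r arc_implies_awalk[OF e] by (blast intro: awalk_appendI)
  let ?x = "\<lambda>i. l (?c ! nat (i mod int (length ?c)))"
  have "?x \<in> label_sequences G l"
    unfolding label_sequences_def using closed_walk_biinfinite_path[OF c] by (intro image_eqI) auto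
  moreover have "map l p = map (\<lambda>j. ?x (0 + int j)) [0..<length p]"
  proof (rule nth_equalityI)
    fix i assume "i < length (map l p)"
    moreover from this have "nat (int i mod int (length ?c)) = i" by simp
    ultimately show "map l p ! i = map (\<lambda>j. ?x (0 + int j)) [0..<length p] ! i"
      by (simp add: nth_append)
  qed simp
  ultimately show ?thesis
    using languageI[of ?x _ 0 "length p"] by simp
qed

section \<open>Phases\<close>

definition phases :: "('b \<Rightarrow> 'c) \<Rightarrow> 'a \<Rightarrow> nat \<Rightarrow> 'c list \<Rightarrow> nat set" where
  "phases l a p v = {length r mod p |r q b. awalk a (r @ q) b \<and> map l q = v}"

lemma phases_subset: "p > 0 \<Longrightarrow> phases l a p v \<subseteq> {..<p}"
  by (auto simp: phases_def)

text \<open>A walk labeled \<open>u @ v\<close> splits where \<open>u\<close> ends. Its first piece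
  can be counted as part of the approach to \<open>v\<close>, which lengthens the approach by
  \<open>length u\<close>.\<close>

lemma phases_append:
  assumes "k \<in> phases l a p (u @ v)"
  shows "k \<in> phases l a p u" and "(k + length u) mod p \<in> phases l a p v"
proof -
  obtain r q b where k: "k = length r mod p" and q: "awalk a (r @ q) b" "map l q = u @ v"
    using assms by (auto simp: phases_def)
  from q(2) obtain q1 q2 where s: "q = q1 @ q2" "map l q1 = u" "map l q2 = v"
    by (auto simp: map_eq_append_conv)
  obtain c where "awalk a (r @ q1) c"
    using q(1) s(1) awalk_append_iff[of a "r @ q1" q2 b] by auto
  then show "k \<in> phases l a p u"
    using s k unfolding phases_def by blast
  have "(k + length u) mod p = length (r @ q1) mod p"
    using k s by (auto simp: mod_simps)
  moreover have "awalk a ((r @ q1) @ q2) b"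
    using q(1) s(1) by simp
  ultimately show "(k + length u) mod p \<in> phases l a p v"
    using s(3) unfolding phases_def by blast
qed

lemma phases_nonempty:
  assumes "strongly_connected G" "a \<in> verts G" "v \<in> language (label_sequences G l)"
  shows "phases l a p v \<noteq> {}"
proof -
  obtain b q c where q: "awalk b q c" "map l q = v"
    using assms(3) by (rule language_label_sequencesE)
  obtain r where "awalk a r b"
    using strongly_connected_awalk[OF assms(1,2)] q(1) by blast
  then have "awalk a (r @ q) c"
    using q(1) by (rule awalk_appendI)
  then show ?thesis
    using q(2) unfolding phases_def by blast
qed

lemma totally_transitive_phases:
  assumes sc: "strongly_connected G" and a: "a \<in> verts G" and p: "p > 0"
    and tt: "totally_transitive X" and X: "language X = language (label_sequences G l)"
    and v: "v \<in> language X"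
  shows "phases l a p v = {..<p}"
proof
  let ?S = "phases l a p"
  show "?S v \<subseteq> {..<p}"
    using p by (rule phases_subset)
  obtain m where m: "m \<in> language X" and min: "\<And>w. w \<in> language X \<Longrightarrow> card (?S m) \<le> card (?S w)"
    using ex_has_least_nat[of "\<lambda>w. w \<in> language X" v "\<lambda>w. card (?S w)"] v by blast
  have sub: "?S m \<subseteq> ?S w" if w: "w \<in> language X" for w
  proof -
    obtain z where z: "m @ z @ w \<in> language X" "p dvd length (m @ z)"
      using tt m w p unfolding totally_transitive_def by blast
    have "?S (m @ z @ w) \<subseteq> ?S m"
      using phases_append(1) by blast
    moreover have "finite (?S m)"
      using finite_subset[OF phases_subset[OF p]] by blast
    \<comment> \<open>A subset of the finite set \<open>?S m\<close> with at least as many elements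
      is all of it.\<close>
    ultimately have "?S m = ?S (m @ z @ w)"
      using card_seteq min[OF z(1)] by metis
    also have "\<dots> \<subseteq> ?S w"
    proof
      fix k assume k: "k \<in> ?S (m @ z @ w)"
      then have "k < p"
        using phases_subset[OF p] by blast
      then have "(k + length (m @ z)) mod p = k"
        using z(2) by (metis mod_less dvd_eq_mod_eq_0 mod_add_right_eq add_0_right)
      then show "k \<in> ?S w"
        using phases_append(2)[of k l a p "m @ z" w] k by simp
    qed
    finally show ?thesis .
  qed
  obtain c where c: "c # m \<in> language X"
    using m by (rule language_left_extension)
  \<comment> \<open>A phase of \<open>m\<close> is also one of \<open>c # m\<close>; moving past the
    letter \<open>c\<close> turns it into the next phase of \<open>m\<close>.\<close>
  have step: "Suc k mod p \<in> ?S m" if "k \<in> ?S m" for k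
    using phases_append(2)[of k l a p "[c]" m] sub[OF c] that by auto
  obtain k where k: "k \<in> ?S m"
    using phases_nonempty[OF sc a] m X by blast
  have all: "(k + n) mod p \<in> ?S m" for n
  proof (induction n)
    case 0
    then show ?case using k phases_subset[OF p] by (metis add_0_right lessThan_iff mod_less subsetD)
  next
    case (Suc n)
    then show ?case using step[OF Suc] by (simp add: mod_simps)
  qed
  show "{..<p} \<subseteq> ?S v"
  proof
    fix n assume n: "n \<in> {..<p}"
    have "k < p" using k phases_subset[OF p] by blast
    \<comment> \<open>Adding \<open>p\<close> before subtracting \<open>k\<close> keeps the natural
      subtraction from truncating.\<close>
    then have "(k + (n + p - k)) mod p = n"
      using n by simp
    then show "n \<in> ?S v"
      using all[of "n + p - k"] sub[OF v] by auto
  qed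
qed

section \<open>Mixing\<close>

lemma awalk_iterate:
  assumes "awalk a c a"
  shows "awalk a (concat (replicate n c)) a"
  using assms by (induction n) (auto simp: awalk_Nil_iff intro: awalk_appendI)

lemma totally_transitive_mixing:
  assumes sc: "strongly_connected G" and tt: "totally_transitive X"
    and X: "language X = language (label_sequences G l)"
  shows "mixing X"
  unfolding mixing_def
proof (intro ballI)
  fix u v assume u: "u \<in> language X" and v: "v \<in> language X"
  \<comment> \<open>Even if \<open>u\<close> is empty, it occurs in the label sequence of some
    bi-infinite path, so the graph has an arc, and a closed walk through it has positive
    length.\<close>
  obtain q i n where "q \<in> biinfinite_paths G"
    using u unfolding X by (auto simp: language_def label_sequences_def)
  then have e: "q 0 \<in> arcs G"
    by (simp add: biinfinite_paths_def)
  define a where "a = tail G (q 0)"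
  have a: "a \<in> verts G"
    using e by (simp add: a_def)
  obtain c' where c': "awalk (head G (q 0)) c' a"
    using strongly_connected_awalk[OF sc _ a] e by (metis head_in_verts)
  define c where "c = q 0 # c'"
  have c: "awalk a c a"
    using c' e by (simp add: c_def a_def awalk_Cons_iff)
  define p where "p = length c"
  have p: "p > 0" by (simp add: p_def c_def)
  obtain s \<alpha> t where \<alpha>: "awalk s \<alpha> t" "map l \<alpha> = u"
    using u X by (metis language_label_sequencesE)
  obtain \<gamma> where \<gamma>: "awalk t \<gamma> a"
    using strongly_connected_awalk[OF sc _ a] \<alpha>(1) by (metis awalk_last_in_verts)
  have "\<exists>r q b. awalk a (r @ q) b \<and> map l q = v \<and> length r mod p = k" if "k < p" for k
  proof -
    have "k \<in> phases l a p v"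
      using totally_transitive_phases[OF sc a p tt X v] that by simp
    then show ?thesis unfolding phases_def by blast
  qed
  then obtain r \<beta> b where r: "\<And>k. k < p \<Longrightarrow> awalk a (r k @ \<beta> k) (b k)"
      "\<And>k. k < p \<Longrightarrow> map l (\<beta> k) = v" "\<And>k. k < p \<Longrightarrow> length (r k) mod p = k"
    by metis
  \<comment> \<open>There are only \<open>p\<close> residues, so one bound covers
    \<open>\<gamma>\<close> together with every approach \<open>r k\<close>. The \<open>Suc\<close>
    makes it positive.\<close>
  define N where "N = Suc (length \<gamma> + (\<Sum>k<p. length (r k)))"
  have "\<exists>w\<in>language_n n X. u @ w @ v \<in> language X" if n: "n > N" for n
  proof -
    \<comment> \<open>The residue of the length still to be filled after \<open>\<gamma>\<close>. As
      \<open>r k\<close> has the same residue, what then remains is a multiple of \<open>p\<close>,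
      filled by \<open>j\<close> rounds of \<open>c\<close>.\<close>
    define k where "k = (n - length \<gamma>) mod p"
    have k: "k < p" using p by (simp add: k_def)
    have le: "length (r k) \<le> n - length \<gamma>"
      using member_le_sum[of k "{..<p}" "\<lambda>k. length (r k)"] k n by (simp add: N_def)
    have "(n - length \<gamma>) mod p = length (r k) mod p"
      using r(3)[OF k] by (simp add: k_def)
    then have "p dvd (n - length \<gamma>) - length (r k)"
      using mod_eq_dvd_iff_nat[OF le] by blast
    then obtain j where j: "n - length \<gamma> - length (r k) = p * j" ..
    let ?w = "\<gamma> @ concat (replicate j c) @ r k"
    have len: "length ?w = n"
      using j le n by (simp add: length_concat sum_list_replicate p_def N_def mult.commute)
    have "awalk s (\<alpha> @ \<gamma> @ concat (replicate j c) @ r k @ \<beta> k) (b k)"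
      using \<alpha>(1) \<gamma> awalk_iterate[OF c, of j] r(1)[OF k] by (blast intro: awalk_appendI)
    then have "map l (\<alpha> @ \<gamma> @ concat (replicate j c) @ r k @ \<beta> k) \<in> language X"
      using language_label_sequencesI[OF sc e] X by metis
    then have uwv: "u @ map l ?w @ v \<in> language X"
      using \<alpha>(2) r(2)[OF k] by simp
    then have "map l ?w \<in> language_n n X"
      using language_factor[OF uwv] len unfolding language_n_def by simp
    then show ?thesis
      using uwv by blast
  qed
  then show "\<exists>N>0. \<forall>n>N. \<exists>w\<in>language_n n X. u @ w @ v \<in> language X"
    by (intro exI[of _ N]) (simp add: N_def)
qed

end

theorem corollary3p2:
  fixes A :: "'a set" and X :: "(int \<Rightarrow> 'a) set"
  assumes "finite A" and "card A \<ge> 2"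
    and "coded_system A X"
    and "totally_transitive X"
  shows "mixing X"
proof -
  obtain G :: "(nat, nat) pre_digraph" and l where "presents A G l X"
    using assms(3) by (auto simp: coded_system_def)
  then have wf: "wf_digraph G" and sc: "strongly_connected G"
    and l: "l \<in> arcs G \<rightarrow> A" and X: "X = full_shift A closure_of label_sequences G l"
    by (auto simp: presents_def)
  \<comment> \<open>As \<open>X\<close> has the same words as the label sequences, and both
    properties speak of words only, the argument can be carried out on walks.\<close>
  have "label_sequences G l \<subseteq> topspace (full_shift A)"
    using l by (auto simp: label_sequences_def biinfinite_paths_def full_shift_def)
  then have "language X = language (label_sequences G l)"
    unfolding X by (rule language_closure_of)
  then show ?thesis
    using wf_digraph.totally_transitive_mixing[OF wf sc assms(4)] by blast
qed

end
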